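(* Let $\Omega$ be a convex polygon with vertices $\mathbf{v}_1,\dots,\mathbf{v}_n$, let $\{\lambda_i\}_{i=1}^n$ be barycentric coordinates on $\Omega$, and let $\{\xi_{ij}\}_{ij\in V\cup E}$ be the functions $\xi_{ij}=\sum_{ab\in I}c^{ij}_{ab}\lambda_a\lambda_b$ constructed with the generic-polygon coefficients described in the context. Then for all $\mathbf{x}\in\Omega$: (1) $\sum_{ii\in V}\xi_{ii}+\sum_{i(i+1)\in E}2\xi_{i(i+1)}=1$; (2) $\sum_{ii\in V}\mathbf{v}_{ii}\xi_{ii}+\sum_{i(i+1)\in E}2\mathbf{v}_{i(i+1)}\xi_{i(i+1)}=\mathbf{x}$; (3) $\sum_{ii\in V}\mathbf{v}_i\mathbf{v}_i^T\xi_{ii}+\sum_{i(i+1)\in E}(\mathbf{v}_i\mathbf{v}_{i+1}^T+\mathbf{v}_{i+1}\mathbf{v}_i^T)\xi_{i(i+1)}=\mathbf{x}\mathbf{x}^T$.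
   Context: Vertices are ordered counter-clockwise and viewed as column vectors in $\mathbb{R}^2$; vertex indices are taken modulo $n$; the interior angle at each vertex is strictly less than $\pi$. Barycentric coordinates on $\Omega$ are functions $\lambda_i:\Omega\to\mathbb{R}$, $i=1,\dots,n$, with $\lambda_i\ge 0$ on $\Omega$ and $L=\sum_{i=1}^n L(\mathbf{v}_i)\lambda_i$ on $\Omega$ for every linear (i.e. affine, degree at most one) function $L:\Omega\to\mathbb{R}$. Index sets: $I=\{\{a,b\}: a,b\in\{1,\dots,n\}\}$ is the set of unordered, possibly non-distinct pairs; $V=\{\{a,a\}\}$, $E=\{\{a,a+1\}: a=1,\dots,n\}$, $D=I\setminus(V\cup E)$. One writes $ab$ for $\{a,b\}$, and $\mathbf{v}_{ab}:=(\mathbf{v}_a+\mathbf{v}_b)/2$ (so $\mathbf{v}_{aa}=\mathbf{v}_a$). Coefficients. For $ab\in V\cup E$: $c^{ij}_{ab}=1$ if $ij=ab$ and $c^{ij}_{ab}=0$ otherwise ($ij\in V\cup E$). For $ab\in D$: apply a rigid motion (rotation and translation) of the plane so that $\mathbf{v}_a=(-\ell,0)$, $\mathbf{v}_b=(\ell,0)$ with $\ell>0$. In these coordinates (subscripts $x,y$ denote components) define $$d_a:=\frac{(\mathbf{v}_{a-1})_x(\mathbf{v}_{a+1})_y-(\mathbf{v}_{a+1})_x(\mathbf{v}_{a-1})_y}{(\mathbf{v}_{a-1})_y-(\mathbf{v}_{a+1})_y}\cdot\frac1\ell,\qquad d_b:=\frac{(\mathbf{v}_{b+1})_x(\mathbf{v}_{b-1})_y-(\mathbf{v}_{b-1})_x(\mathbf{v}_{b+1})_y}{(\mathbf{v}_{b-1})_y-(\mathbf{v}_{b+1})_y}\cdot\frac1\ell,$$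 (so $-d_a\ell$ and $d_b\ell$ are the $x$-intercepts of the lines through $\mathbf{v}_{a-1},\mathbf{v}_{a+1}$ and through $\mathbf{v}_{b-1},\mathbf{v}_{b+1}$), and $s:=\frac{2}{2-(d_a+d_b)}$. Then $c^{(a-1)a}_{ab},c^{a(a+1)}_{ab}$ are the unique solution of $$c^{(a-1)a}_{ab}+c^{a(a+1)}_{ab}=s,\qquad c^{(a-1)a}_{ab}\mathbf{v}_{a-1}+c^{a(a+1)}_{ab}\mathbf{v}_{a+1}=s\,d_a\mathbf{v}_a,$$ $c^{(b-1)b}_{ab},c^{b(b+1)}_{ab}$ are the unique solution of $$c^{(b-1)b}_{ab}+c^{b(b+1)}_{ab}=s,\qquad c^{(b-1)b}_{ab}\mathbf{v}_{b-1}+c^{b(b+1)}_{ab}\mathbf{v}_{b+1}=s\,d_b\mathbf{v}_b,$$ $$c^{aa}_{ab}=\frac{-2-2d_a}{2-(d_a+d_b)},\qquad c^{bb}_{ab}=\frac{-2-2d_b}{2-(d_a+d_b)},$$ and all other $c^{ij}_{ab}$ with $ij\in V\cup E$ are $0$. *)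

theory Defs
  imports "HOL-Analysis.Analysis"
begin

text \<open>
  Vertices are indexed by \<open>1, \<dots>, n\<close>, and indices are read modulo \<open>n\<close>:
  \<open>nxt n a\<close> is \<open>a + 1\<close> and \<open>prv n a\<close> is \<open>a - 1\<close>.
\<close>

definition nxt :: "nat \<Rightarrow> nat \<Rightarrow> nat" where
  "nxt n a = (if a = n then 1 else a + 1)"

definition prv :: "nat \<Rightarrow> nat \<Rightarrow> nat" where
  "prv n a = (if a = 1 then n else a - 1)"

text \<open>
  The vertices are exactly the extreme points of the polygon, so every interior angle is
  strictly less than \<open>\<pi>\<close>. The determinant condition says that the boundary turns left at
  every vertex, i.e.\ that the vertices are listed counter-clockwise.
\<close>

definition convex_polygon :: "nat \<Rightarrow> (nat \<Rightarrow> real^2) \<Rightarrow> (real^2) set \<Rightarrow> bool" where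
  "convex_polygon n v \<Omega> \<longleftrightarrow>
     n \<ge> 3 \<and> inj_on v {1..n} \<and>
     \<Omega> = convex hull (v ` {1..n}) \<and>
     {x. x extreme_point_of \<Omega>} = v ` {1..n} \<and>
     (\<forall>i\<in>{1..n}. closed_segment (v i) (v (nxt n i)) edge_of \<Omega>) \<and>
     (\<forall>i\<in>{1..n}. det (vector [v i - v (prv n i), v (nxt n i) - v i] :: real^2^2) > 0)"

text \<open>The functions \<open>L x = f x + k\<close> with \<open>f\<close> linear are those of degree at most one.\<close>

definition barycentric_coordinates ::
    "nat \<Rightarrow> (nat \<Rightarrow> real^2) \<Rightarrow> (real^2) set \<Rightarrow> (nat \<Rightarrow> real^2 \<Rightarrow> real) \<Rightarrow> bool" where
  "barycentric_coordinates n v \<Omega> lam \<longleftrightarrow>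
     (\<forall>i\<in>{1..n}. \<forall>x\<in>\<Omega>. lam i x \<ge> 0) \<and>
     (\<forall>(f :: real^2 \<Rightarrow> real) (k :: real). linear f \<longrightarrow>
        (\<forall>x\<in>\<Omega>. f x + k = (\<Sum>i=1..n. (f (v i) + k) * lam i x)))"

definition pairs_I :: "nat \<Rightarrow> nat set set" where
  "pairs_I n = {{a, b} | a b. a \<in> {1..n} \<and> b \<in> {1..n}}"

definition pairs_V :: "nat \<Rightarrow> nat set set" where
  "pairs_V n = {{a, a} | a. a \<in> {1..n}}"

definition pairs_E :: "nat \<Rightarrow> nat set set" where
  "pairs_E n = {{a, nxt n a} | a. a \<in> {1..n}}"

definition pairs_D :: "nat \<Rightarrow> nat set set" where
  "pairs_D n = pairs_I n - (pairs_V n \<union> pairs_E n)"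

definition midpt :: "(nat \<Rightarrow> real^2) \<Rightarrow> nat \<Rightarrow> nat \<Rightarrow> real^2" where
  "midpt v a b = (v a + v b) /\<^sub>R 2"

definition rigid_motion :: "(real^2 \<Rightarrow> real^2) \<Rightarrow> bool" where
  "rigid_motion T \<longleftrightarrow>
     (\<exists>(R :: real^2^2) t. rotation_matrix R \<and> (\<forall>x. T x = R *v x + t))"

text \<open>
  For \<open>v a \<noteq> v b\<close> exactly one rigid motion has the required property, so the choice
  operator is harmless. \<open>placed v a b\<close> is the family of moved vertices and
  \<open>half_len v a b\<close> is \<open>\<ell>\<close>.
\<close>

definition placing_motion :: "(nat \<Rightarrow> real^2) \<Rightarrow> nat \<Rightarrow> nat \<Rightarrow> real^2 \<Rightarrow> real^2" where
  "placing_motion v a b =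
     (SOME T. rigid_motion T \<and>
        (\<exists>l>0. T (v a) = vector [- l, 0] \<and> T (v b) = vector [l, 0]))"

definition placed :: "(nat \<Rightarrow> real^2) \<Rightarrow> nat \<Rightarrow> nat \<Rightarrow> nat \<Rightarrow> real^2" where
  "placed v a b i = placing_motion v a b (v i)"

definition half_len :: "(nat \<Rightarrow> real^2) \<Rightarrow> nat \<Rightarrow> nat \<Rightarrow> real" where
  "half_len v a b = placed v a b b $ 1"

definition d_fst :: "nat \<Rightarrow> (nat \<Rightarrow> real^2) \<Rightarrow> nat \<Rightarrow> nat \<Rightarrow> real" where
  "d_fst n v a b =
     (let p = placed v a b (prv n a); q = placed v a b (nxt n a)
      in (p $ 1 * q $ 2 - q $ 1 * p $ 2) / (p $ 2 - q $ 2) * (1 / half_len v a b))"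

definition d_snd :: "nat \<Rightarrow> (nat \<Rightarrow> real^2) \<Rightarrow> nat \<Rightarrow> nat \<Rightarrow> real" where
  "d_snd n v a b =
     (let p = placed v a b (prv n b); q = placed v a b (nxt n b)
      in (q $ 1 * p $ 2 - p $ 1 * q $ 2) / (p $ 2 - q $ 2) * (1 / half_len v a b))"

definition s_par :: "nat \<Rightarrow> (nat \<Rightarrow> real^2) \<Rightarrow> nat \<Rightarrow> nat \<Rightarrow> real" where
  "s_par n v a b = 2 / (2 - (d_fst n v a b + d_snd n v a b))"

text \<open>
  For \<open>e = a\<close> and \<open>d = d_a\<close> (likewise for \<open>e = b\<close> and \<open>d = d_b\<close>) this is the pair of
  coefficients of \<open>{e - 1, e}\<close> and \<open>{e, e + 1}\<close>. The vector equation is not invariant under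
  translations; it is meant in the moved coordinates.
\<close>

definition edge_coeffs :: "nat \<Rightarrow> (nat \<Rightarrow> real^2) \<Rightarrow> nat \<Rightarrow> nat \<Rightarrow> nat \<Rightarrow> real \<Rightarrow> real \<times> real" where
  "edge_coeffs n v a b e d =
     (THE (p, q). p + q = s_par n v a b \<and>
        p *\<^sub>R placed v a b (prv n e) + q *\<^sub>R placed v a b (nxt n e)
          = (s_par n v a b * d) *\<^sub>R placed v a b e)"

definition diag_coeff :: "nat \<Rightarrow> (nat \<Rightarrow> real^2) \<Rightarrow> nat \<Rightarrow> nat \<Rightarrow> nat set \<Rightarrow> real" where
  "diag_coeff n v a b ij =
     (let da = d_fst n v a b; db = d_snd n v a b in
      if ij = {prv n a, a} then fst (edge_coeffs n v a b a da)
      else if ij = {a, nxt n a} then snd (edge_coeffs n v a b a da)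
      else if ij = {prv n b, b} then fst (edge_coeffs n v a b b db)
      else if ij = {b, nxt n b} then snd (edge_coeffs n v a b b db)
      else if ij = {a, a} then (- 2 - 2 * da) / (2 - (da + db))
      else if ij = {b, b} then (- 2 - 2 * db) / (2 - (da + db))
      else 0)"

text \<open>
  \<open>coeff n v ab ij\<close> is $c^{ij}_{ab}$. The pair \<open>ab = {a, b}\<close> is read with
  \<open>a = Min ab\<close> and \<open>b = Max ab\<close>; exchanging \<open>a\<close> and \<open>b\<close> rotates the moved coordinates
  by \<open>\<pi>\<close> and leaves the coefficients unchanged.
\<close>

definition coeff :: "nat \<Rightarrow> (nat \<Rightarrow> real^2) \<Rightarrow> nat set \<Rightarrow> nat set \<Rightarrow> real" where
  "coeff n v ab ij =
     (if ab \<in> pairs_D n then diag_coeff n v (Min ab) (Max ab) ij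
      else if ij = ab then 1 else 0)"

definition xi :: "nat \<Rightarrow> (nat \<Rightarrow> real^2) \<Rightarrow> (nat \<Rightarrow> real^2 \<Rightarrow> real) \<Rightarrow> nat set \<Rightarrow> real^2 \<Rightarrow> real" where
  "xi n v lam ij x =
     (\<Sum>ab\<in>pairs_I n. coeff n v ab ij * (lam (Min ab) x * lam (Max ab) x))"

definition outer :: "real^2 \<Rightarrow> real^2 \<Rightarrow> real^2^2" where
  "outer u w = (columnvector u :: real^1^2) ** transpose (columnvector w :: real^1^2)"

end

theory Submission
  imports Defs
begin

text \<open>
  Let \<open>f\<close> and \<open>g\<close> be functions of degree at most one and write \<open>f\<^sub>i\<close> for the value of \<open>f\<close> at
  the vertex \<open>v i\<close>.  All three identities are instances of
  \[ \sum_i f_i g_i\,\xi_{ii} + \sum_i (f_i g_{i+1} + f_{i+1} g_i)\,\xi_{i(i+1)} = f(x)\,g(x), \]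
  with \<open>f\<close> and \<open>g\<close> chosen among the constant \<open>1\<close> and the two coordinate functions.  By linear
  precision of the \<open>\<lambda>\<^sub>i\<close>, the right-hand side is the sum over unordered pairs \<open>{a, b}\<close> of
  \<open>h\<^sub>a\<^sub>b \<lambda>\<^sub>a \<lambda>\<^sub>b\<close>, where \<open>h\<^sub>a\<^sub>b\<close> is \<open>f\<^sub>a g\<^sub>b + f\<^sub>b g\<^sub>a\<close> (or \<open>f\<^sub>a g\<^sub>a\<close> on the diagonal) (\<open>affine_product\<close>).
  So it suffices to compare the coefficients of \<open>\<lambda>\<^sub>a \<lambda>\<^sub>b\<close> on the two sides
  (\<open>coeff_reproduces\<close>): the coefficients \<open>c\<close> must express \<open>h\<^sub>a\<^sub>b\<close> through the values of \<open>h\<close> at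
  vertices and edges.

  This is trivial unless \<open>ab\<close> is a diagonal.  For a diagonal the equations that
  define the coefficients at the edges through \<open>a\<close> say, for every \<open>f\<close> of degree at most one, that
  \[ p\,f_{a-1} + q\,f_{a+1} = \tfrac s2\bigl((1 + d_a) f_a + (1 - d_a) f_b\bigr), \]
  and similarly at \<open>b\<close>.  Multiplying by \<open>g\<^sub>a\<close> and symmetrising, the two edges at \<open>a\<close> contribute
  \<open>s (1 + d\<^sub>a) f\<^sub>a g\<^sub>a\<close>, which the vertex coefficient cancels, and
  \<open>s (1 - d\<^sub>a) h\<^sub>a\<^sub>b / 2\<close>.  With the contribution of \<open>b\<close> the total is
  \<open>s (2 - d\<^sub>a - d\<^sub>b) h\<^sub>a\<^sub>b / 2 = h\<^sub>a\<^sub>b\<close>.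

  Convexity enters only to show that these quantities are well defined: the
  neighbours of \<open>a\<close> lie strictly on opposite sides of the diagonal (\<open>left_of_edge\<close>), which makes
  the denominator in \<open>d\<^sub>a\<close> nonzero, and the left turn at \<open>a\<close> then amounts to \<open>d\<^sub>a < 1\<close>, so that
  \<open>2 - d\<^sub>a - d\<^sub>b\<close> is positive (\<open>edge_coeffs_equations\<close>).
\<close>

section \<open>Cyclic indices\<close>

lemma nxt_range: "a \<in> {1..n} \<Longrightarrow> nxt n a \<in> {1..n}"
  by (auto simp: nxt_def)

lemma prv_range: "a \<in> {1..n} \<Longrightarrow> prv n a \<in> {1..n}"
  by (auto simp: prv_def)

lemma nxt_prv: "a \<in> {1..n} \<Longrightarrow> nxt n (prv n a) = a"
  by (auto simp: prv_def nxt_def)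

lemma prv_nxt: "a \<in> {1..n} \<Longrightarrow> prv n (nxt n a) = a"
  by (auto simp: prv_def nxt_def)

lemma neighbours_distinct:
  assumes "n \<ge> 3" "a \<in> {1..n}"
  shows "nxt n a \<noteq> a" "prv n a \<noteq> a" "nxt n a \<noteq> prv n a" "nxt n (nxt n a) \<noteq> a"
  using assms by (auto simp: prv_def nxt_def)

lemma edge_eq_iff:
  assumes "n \<ge> 3" "i \<in> {1..n}" "j \<in> {1..n}"
  shows "{i, nxt n i} = {j, nxt n j} \<longleftrightarrow> i = j"
  using neighbours_distinct[OF assms(1)] assms by (metis doubleton_eq_iff)

lemma Min_Max_pair:
  fixes a b :: nat
  shows "{Min {a, b}, Max {a, b}} = {a, b}"
  by (auto simp: min_def max_def)

lemma pairs_I_Min_Max: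
  assumes "ab \<in> pairs_I n"
  shows "Min ab \<in> {1..n}" "Max ab \<in> {1..n}" "ab = {Min ab, Max ab}" "Min ab \<le> Max ab"
proof -
  obtain a b where ab: "ab = {a, b}" "a \<in> {1..n}" "b \<in> {1..n}"
    using assms by (auto simp: pairs_I_def)
  show "Min ab \<in> {1..n}" "Max ab \<in> {1..n}" "Min ab \<le> Max ab"
    using ab by (auto simp: min_def max_def)
  show "ab = {Min ab, Max ab}" unfolding ab(1) by (rule Min_Max_pair[symmetric])
qed

lemma pairs_D_nonadjacent:
  assumes "ab \<in> pairs_D n"
  shows "Min ab \<noteq> Max ab" "Max ab \<noteq> nxt n (Min ab)" "Min ab \<noteq> nxt n (Max ab)"
proof -
  have ab: "ab \<in> pairs_I n" "ab \<notin> pairs_V n" "ab \<notin> pairs_E n"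
    using assms by (auto simp: pairs_D_def)
  note M = pairs_I_Min_Max[OF ab(1)]
  show "Min ab \<noteq> Max ab"
    using ab(2) M unfolding pairs_V_def by (metis (mono_tags, lifting) CollectI)
  show "Max ab \<noteq> nxt n (Min ab)"
    using ab(3) M unfolding pairs_E_def by (metis (mono_tags, lifting) CollectI)
  show "Min ab \<noteq> nxt n (Max ab)"
    using ab(3) M unfolding pairs_E_def by (metis (mono_tags, lifting) CollectI insert_commute)
qed

section \<open>Vertices strictly to the left of an edge\<close>

definition cross :: "real^2 \<Rightarrow> real^2 \<Rightarrow> real" where
  "cross u w = u $ 1 * w $ 2 - u $ 2 * w $ 1"

lemma det_vector_eq_cross: "det (vector [u, w] :: real^2^2) = cross u w"
  by (simp add: det_2 cross_def)

text \<open>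
  A normal vector to \<open>u\<close> in the plane is a multiple of \<open>u\<close> rotated by a right angle, so its
  inner products have the same sign pattern as \<open>cross u\<close>, up to a global sign.
\<close>

lemma inner_normal_eq_cross:
  fixes u \<nu> :: "real^2"
  assumes "u \<noteq> 0" "\<nu> \<bullet> u = 0"
  obtains c where "\<And>w. \<nu> \<bullet> w = c * cross u w"
proof
  have nz: "(u $ 1)\<^sup>2 + (u $ 2)\<^sup>2 \<noteq> 0"
    using assms(1) by (auto simp: vec_eq_iff forall_2 sum_power2_eq_zero_iff)
  let ?c = "cross u \<nu> / ((u $ 1)\<^sup>2 + (u $ 2)\<^sup>2)"
  have o: "\<nu> $ 1 * u $ 1 + \<nu> $ 2 * u $ 2 = 0"
    using assms(2) by (simp add: inner_vec_def sum_2)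
  fix w
  have "cross u \<nu> * cross u w = (\<nu> \<bullet> w) * ((u $ 1)\<^sup>2 + (u $ 2)\<^sup>2)"
    using o unfolding cross_def inner_vec_def sum_2 inner_real_def by algebra
  then show "\<nu> \<bullet> w = ?c * cross u w"
    using nz by (simp add: field_simps)
qed

text \<open>
  An edge is an exposed face, so it lies on a supporting line, which meets no vertex
  other than the two endpoints of the edge because vertices are extreme points.  Hence all other
  vertices lie strictly on one side; the left turn at the end of the edge tells which one.
\<close>

lemma left_of_edge:
  assumes P: "convex_polygon n v \<Omega>" and i: "i \<in> {1..n}" and k: "k \<in> {1..n}" "k \<noteq> i" "k \<noteq> nxt n i"
  shows "cross (v (nxt n i) - v i) (v k - v i) > 0"
proof -
  have n: "n \<ge> 3" and inj: "inj_on v {1..n}" and hull: "\<Omega> = convex hull (v ` {1..n})"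
    and ext: "{x. x extreme_point_of \<Omega>} = v ` {1..n}"
    and edge: "closed_segment (v i) (v (nxt n i)) edge_of \<Omega>"
    using P i by (auto simp: convex_polygon_def)
  let ?j = "nxt n i" and ?k = "nxt n (nxt n i)"
  let ?S = "closed_segment (v i) (v ?j)"
  have j: "?j \<in> {1..n}" and k2: "?k \<in> {1..n}" using i nxt_range by blast+
  have turn: "cross (v ?j - v i) (v ?k - v ?j) > 0"
    using P j prv_nxt[OF i] unfolding convex_polygon_def det_vector_eq_cross by metis
  have vne: "v ?j - v i \<noteq> 0"
    using inj i j neighbours_distinct[OF n i] by (auto dest: inj_onD)
  have "polyhedron \<Omega>"
    unfolding hull by (intro polytope_imp_polyhedron polytope_convex_hull) auto
  then have "?S exposed_face_of \<Omega>"
    using edge by (simp add: edge_of_def exposed_face_of_polyhedron)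
  then obtain \<nu> \<beta> where le: "\<Omega> \<subseteq> {x. \<nu> \<bullet> x \<le> \<beta>}" and S: "?S = \<Omega> \<inter> {x. \<nu> \<bullet> x = \<beta>}"
    unfolding exposed_face_of_def by blast
  have on: "\<nu> \<bullet> v i = \<beta>" "\<nu> \<bullet> v ?j = \<beta>" using S by auto
  \<comment> \<open>Any other vertex on the supporting line would be an extreme point interior to the edge.\<close>
  have neg: "\<nu> \<bullet> (v m - v i) < 0" if m: "m \<in> {1..n}" "m \<noteq> i" "m \<noteq> ?j" for m
  proof -
    have e: "v m extreme_point_of \<Omega>" using ext m by blast
    have ends: "v i \<in> \<Omega>" "v ?j \<in> \<Omega>" using S by auto
    have "v m \<notin> ?S"
    proof
      assume "v m \<in> ?S"
      moreover have "v m \<noteq> v i" "v m \<noteq> v ?j" using inj i j m by (auto dest: inj_onD)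
      ultimately have "v m \<in> open_segment (v i) (v ?j)" by (simp add: open_segment_def)
      with e ends show False by (auto simp: extreme_point_of_def)
    qed
    moreover have "v m \<in> \<Omega>" using e by (simp add: extreme_point_of_def)
    ultimately have "\<nu> \<bullet> v m < \<beta>" using le S by force
    then show ?thesis using on by (simp add: inner_diff_right)
  qed
  have "\<nu> \<bullet> (v ?j - v i) = 0" using on by (simp add: inner_diff_right)
  then obtain c where c: "\<And>w. \<nu> \<bullet> w = c * cross (v ?j - v i) w"
    using inner_normal_eq_cross[OF vne] by blast
  have "cross (v ?j - v i) (v ?k - v i) = cross (v ?j - v i) (v ?k - v ?j)"
    by (simp add: cross_def algebra_simps)
  then have "cross (v ?j - v i) (v ?k - v i) > 0" using turn by simp
  moreover have "c * cross (v ?j - v i) (v ?k - v i) < 0"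
    using neg[OF k2] neighbours_distinct[OF n i] neighbours_distinct[OF n j] c by auto
  ultimately have "c < 0" by (simp add: mult_less_0_iff)
  moreover have "c * cross (v ?j - v i) (v k - v i) < 0"
    using neg k c by metis
  ultimately show ?thesis by (simp add: mult_less_0_iff)
qed

section \<open>The moved coordinates\<close>

lemma placing_motion_exists:
  fixes A B :: "real^2"
  assumes "A \<noteq> B"
  shows "\<exists>T. rigid_motion T \<and> (\<exists>l>0. T A = vector [- l, 0] \<and> T B = vector [l, 0])"
proof -
  define N where "N = norm (B - A)"
  define c where "c = (B - A) $ 1 / N"
  define s where "s = (B - A) $ 2 / N"
  define R :: "real^2^2" where "R = vector [vector [c, s], vector [- s, c]]"
  define T where "T x = R *v x + - (R *v ((1 / 2) *\<^sub>R (A + B)))" for x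
  have N: "N > 0" using assms by (simp add: N_def)
  have NN: "((B - A) $ 1)\<^sup>2 + ((B - A) $ 2)\<^sup>2 = N\<^sup>2"
    unfolding N_def power2_norm_eq_inner by (simp add: inner_vec_def sum_2 power2_eq_square)
  have "N\<^sup>2 * (c\<^sup>2 + s\<^sup>2) = N\<^sup>2 * 1"
    using N NN by (simp add: c_def s_def power_divide field_simps)
  then have cs: "c\<^sup>2 + s\<^sup>2 = 1" using N by simp
  have "rotation_matrix R"
    unfolding rotation_matrix_def orthogonal_matrix using cs
    by (simp add: R_def det_2 vec_eq_iff forall_2 matrix_matrix_mult_def transpose_def sum_2
        mat_def power2_eq_square algebra_simps)
  then have "rigid_motion T" unfolding rigid_motion_def T_def by blast
  moreover have "T B = vector [N / 2, 0]" "T A = vector [- (N / 2), 0]"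
  proof -
    have "c * (B - A) $ 1 + s * (B - A) $ 2 = (((B - A) $ 1)\<^sup>2 + ((B - A) $ 2)\<^sup>2) / N"
      by (simp only: c_def s_def power2_eq_square add_divide_distrib times_divide_eq_left)
    also have "\<dots> = N" unfolding NN using N by (simp add: power2_eq_square)
    finally have "c * (B - A) $ 1 + s * (B - A) $ 2 = N" .
    moreover have "c * (B - A) $ 2 = s * (B - A) $ 1" by (simp add: c_def s_def)
    ultimately show "T B = vector [N / 2, 0]" "T A = vector [- (N / 2), 0]"
      by (simp_all add: T_def R_def vec_eq_iff forall_2 matrix_vector_mult_def sum_2 algebra_simps)
  qed
  ultimately show ?thesis using N by (intro exI[of _ T] conjI exI[of _ "N / 2"]) auto
qed

text \<open>
  The midpoint of the two marked vertices is moved to the origin, so the motion is a rotation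
  about that midpoint followed by a translation.
\<close>

lemma placed_eq_rotation:
  assumes "v a \<noteq> v b"
  obtains R :: "real^2^2" where "rotation_matrix R" "\<And>i. placed v a b i = R *v (v i - midpt v a b)"
    "half_len v a b > 0"
    "placed v a b a = vector [- half_len v a b, 0]" "placed v a b b = vector [half_len v a b, 0]"
proof -
  let ?T = "placing_motion v a b"
  have "rigid_motion ?T \<and> (\<exists>l>0. ?T (v a) = vector [- l, 0] \<and> ?T (v b) = vector [l, 0])"
    unfolding placing_motion_def by (rule someI_ex[OF placing_motion_exists[OF assms]])
  then obtain R t l where R: "rotation_matrix R" "\<And>x. ?T x = R *v x + t"
    and l: "l > 0" "?T (v a) = vector [- l, 0]" "?T (v b) = vector [l, 0]"
    unfolding rigid_motion_def by blast
  have hl: "half_len v a b = l" by (simp add: half_len_def placed_def l)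
  have "?T (v a) + ?T (v b) = 0" unfolding l by (simp add: vec_eq_iff forall_2)
  then have "R *v v a + t + (R *v v b + t) = 0" by (simp only: R(2))
  moreover have "R *v midpt v a b = (1 / 2) *\<^sub>R (R *v v a + R *v v b)"
    by (simp add: midpt_def matrix_vector_mult_scaleR matrix_vector_right_distrib)
  ultimately have t: "t = - (R *v midpt v a b)"
    by (simp add: vec_eq_iff forall_2 field_simps)
  show thesis
  proof (rule that[OF R(1)])
    show "placed v a b i = R *v (v i - midpt v a b)" for i
      by (simp add: placed_def R(2) t matrix_vector_mult_diff_distrib)
  qed (use l hl in \<open>simp_all add: placed_def\<close>)
qed

lemma cross_rotation:
  assumes "rotation_matrix R"
  shows "cross (R *v u) (R *v w) = cross u w"
proof -
  have "cross (R *v u) (R *v w) = det R * cross u w"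
    by (simp add: cross_def matrix_vector_mult_def sum_2 det_2 algebra_simps)
  then show ?thesis using assms by (simp add: rotation_matrix_def)
qed

lemma rotation_eq_0_iff:
  assumes "rotation_matrix R"
  shows "R *v u = 0 \<longleftrightarrow> u = 0"
proof
  assume "R *v u = 0"
  then have "transpose R *v (R *v u) = 0" by simp
  moreover have "transpose R ** R = mat 1"
    using assms by (simp add: rotation_matrix_def orthogonal_matrix_def)
  ultimately show "u = 0" by (simp add: matrix_vector_mul_assoc)
qed simp

section \<open>The coefficients of a diagonal\<close>

text \<open>
  The weights of the point where the line through \<open>P\<close> and \<open>Q\<close> meets the first axis, scaled by
  \<open>s\<close>.  They are the unique solution because \<open>P\<close> and \<open>Q\<close> have different heights.
\<close>

lemma intercept_weights:
  fixes P Q :: "real^2"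
  assumes "P $ 2 \<noteq> Q $ 2" and z: "z = (Q $ 1 * P $ 2 - P $ 1 * Q $ 2) / (P $ 2 - Q $ 2)"
  shows "\<exists>!(p, q). p + q = s \<and> p *\<^sub>R P + q *\<^sub>R Q = vector [s * z, 0]"
proof -
  have nz: "P $ 2 - Q $ 2 \<noteq> 0" using assms by simp
  show ?thesis
  proof (rule ex1I[of _ "((- s * Q $ 2) / (P $ 2 - Q $ 2), s * P $ 2 / (P $ 2 - Q $ 2))"], goal_cases)
    case 1
    show ?case
      using nz by (simp add: z vec_eq_iff forall_2 divide_simps) (simp add: algebra_simps)
  next
    case (2 y)
    obtain p q where y: "y = (p, q)" by force
    have e: "p + q = s" "p * P $ 2 + q * Q $ 2 = 0"
      using 2 by (auto simp: y vec_eq_iff forall_2)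
    have "p * (P $ 2 - Q $ 2) = - s * Q $ 2" "q * (P $ 2 - Q $ 2) = s * P $ 2"
      unfolding e(1)[symmetric] using e(2) by (simp_all add: algebra_simps)
    then show ?case unfolding y prod.inject nonzero_eq_divide_eq[OF nz] by simp
  qed
qed

text \<open>
  The moved coordinates are left behind here: the midpoint \<open>m\<close> takes the role of their origin, so
  the equations that define the edge coefficients become equations between vectors from \<open>m\<close>,
  and the rotation drops out because it is injective.

  By \<open>left_of_edge\<close> for the four edges at \<open>a\<close> and \<open>b\<close>, the moved predecessor of \<open>a\<close> lies above
  and its successor below the first axis, and the other way round at \<open>b\<close>.  The left turn
  at \<open>a\<close> then says that the line through its neighbours meets the axis strictly to the right of
  \<open>a\<close>, that is \<open>d\<^sub>a < 1\<close>; likewise \<open>d\<^sub>b < 1\<close>.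
\<close>

lemma edge_coeffs_equations:
  assumes P: "convex_polygon n v \<Omega>" and a: "a \<in> {1..n}" and b: "b \<in> {1..n}"
    and ab: "a \<noteq> b" "b \<noteq> nxt n a" "a \<noteq> nxt n b"
  defines "da \<equiv> d_fst n v a b" and "db \<equiv> d_snd n v a b" and "s \<equiv> s_par n v a b"
  defines "m \<equiv> midpt v a b"
  shows "da + db < 2"
    and "case edge_coeffs n v a b a da of (p, q) \<Rightarrow> p + q = s \<and>
           p *\<^sub>R (v (prv n a) - m) + q *\<^sub>R (v (nxt n a) - m) = (s * da) *\<^sub>R (v a - m)"
    and "case edge_coeffs n v a b b db of (p, q) \<Rightarrow> p + q = s \<and>
           p *\<^sub>R (v (prv n b) - m) + q *\<^sub>R (v (nxt n b) - m) = (s * db) *\<^sub>R (v b - m)"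
proof -
  have n: "n \<ge> 3" and inj: "inj_on v {1..n}" using P by (auto simp: convex_polygon_def)
  have "v a \<noteq> v b" using inj a b ab by (auto dest: inj_onD)
  then obtain R where R: "rotation_matrix R"
    and pl: "\<And>i. placed v a b i = R *v (v i - midpt v a b)"
    and l: "half_len v a b > 0"
      "placed v a b a = vector [- half_len v a b, 0]" "placed v a b b = vector [half_len v a b, 0]"
    using placed_eq_rotation by blast
  define l where "l = half_len v a b"
  have l0: "l > 0" and pa: "placed v a b a = vector [- l, 0]" and pb: "placed v a b b = vector [l, 0]"
    using l by (auto simp: l_def)
  have cr: "cross (placed v a b i - placed v a b j) (placed v a b k - placed v a b h)
      = cross (v i - v j) (v k - v h)" for i j k h
    by (simp add: pl cross_rotation[OF R] flip: matrix_vector_mult_diff_distrib)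
  have left: "cross (placed v a b (nxt n i) - placed v a b i) (placed v a b k - placed v a b i) > 0"
    if "i \<in> {1..n}" "k \<in> {1..n}" "k \<noteq> i" "k \<noteq> nxt n i" for i k
    using left_of_edge[OF P that] by (simp add: cr)
  have turn: "cross (placed v a b i - placed v a b (prv n i)) (placed v a b (nxt n i) - placed v a b i) > 0"
    if "i \<in> {1..n}" for i
    using P that by (simp add: cr convex_polygon_def det_vector_eq_cross)
  let ?pa = "placed v a b (prv n a)" and ?qa = "placed v a b (nxt n a)"
  let ?pb = "placed v a b (prv n b)" and ?qb = "placed v a b (nxt n b)"
  have "cross (placed v a b a - ?pa) (placed v a b b - ?pa) > 0"
    using left[of "prv n a" b] prv_range[OF a] nxt_prv[OF a] nxt_prv[OF b] a b ab
    by metis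
  then have "2 * l * ?pa $ 2 > 0" by (simp add: pa pb cross_def algebra_simps)
  then have pa2: "?pa $ 2 > 0" using l0 by (simp add: zero_less_mult_iff)
  have "cross (?qa - placed v a b a) (placed v a b b - placed v a b a) > 0"
    using left[OF a b] ab by simp
  then have "2 * l * ?qa $ 2 < 0" by (simp add: pa pb cross_def algebra_simps)
  then have qa2: "?qa $ 2 < 0" using l0 by (simp add: mult_less_0_iff)
  have "cross (placed v a b b - ?pb) (placed v a b a - ?pb) > 0"
    using left[of "prv n b" a] prv_range[OF b] nxt_prv[OF a] nxt_prv[OF b] a b ab
    by metis
  then have "2 * l * ?pb $ 2 < 0" by (simp add: pa pb cross_def algebra_simps)
  then have pb2: "?pb $ 2 < 0" using l0 by (simp add: mult_less_0_iff)
  have "cross (?qb - placed v a b b) (placed v a b a - placed v a b b) > 0"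
    using left[OF b a] ab by simp
  then have "2 * l * ?qb $ 2 > 0" by (simp add: pa pb cross_def algebra_simps)
  then have qb2: "?qb $ 2 > 0" using l0 by (simp add: zero_less_mult_iff)
  have da: "da * l = (?pa $ 1 * ?qa $ 2 - ?qa $ 1 * ?pa $ 2) / (?pa $ 2 - ?qa $ 2)"
    using l0 by (simp add: da_def d_fst_def Let_def l_def)
  have db: "db * l = (?qb $ 1 * ?pb $ 2 - ?pb $ 1 * ?qb $ 2) / (?pb $ 2 - ?qb $ 2)"
    using l0 by (simp add: db_def d_snd_def Let_def l_def)
  have "da * l * (?pa $ 2 - ?qa $ 2) < l * (?pa $ 2 - ?qa $ 2)"
    using turn[OF a] pa2 qa2 unfolding da by (simp add: pa cross_def) (simp add: algebra_simps)
  then have da1: "da < 1" using pa2 qa2 l0 by (simp add: mult_less_cancel_right)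
  have "db * l * (?pb $ 2 - ?qb $ 2) > l * (?pb $ 2 - ?qb $ 2)"
    using turn[OF b] pb2 qb2 unfolding db by (simp add: pb cross_def) (simp add: algebra_simps)
  then have db1: "db < 1" using pb2 qb2 l0 by (simp add: mult_less_cancel_right)
  show "da + db < 2" using da1 db1 by simp
  have unrotate: "p *\<^sub>R (v i - m) + q *\<^sub>R (v j - m) = r *\<^sub>R (v k - m)"
    if "p *\<^sub>R placed v a b i + q *\<^sub>R placed v a b j = r *\<^sub>R placed v a b k" for p q r i j k
  proof -
    have "R *v (p *\<^sub>R (v i - m) + q *\<^sub>R (v j - m) - r *\<^sub>R (v k - m)) = 0"
      using that by (simp add: pl m_def matrix_vector_mult_diff_distrib
          matrix_vector_right_distrib matrix_vector_mult_scaleR)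
    then show ?thesis using rotation_eq_0_iff[OF R] by simp
  qed
  \<comment> \<open>The intercept is \<open>- da * l\<close> at the left end of the diagonal and \<open>db * l\<close> at the right end.\<close>
  have ua: "(s * da) *\<^sub>R placed v a b a = vector [s * (- (da * l)), 0]"
    by (simp add: pa vec_eq_iff forall_2)
  have "\<exists>!(p, q). p + q = s \<and> p *\<^sub>R ?pa + q *\<^sub>R ?qa = (s * da) *\<^sub>R placed v a b a"
    unfolding ua by (rule intercept_weights) (use pa2 qa2 da in \<open>auto simp: field_simps\<close>)
  from theI'[OF this] show "case edge_coeffs n v a b a da of (p, q) \<Rightarrow> p + q = s \<and>
           p *\<^sub>R (v (prv n a) - m) + q *\<^sub>R (v (nxt n a) - m) = (s * da) *\<^sub>R (v a - m)"
    unfolding edge_coeffs_def s_def by (auto intro: unrotate)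
  have ub: "(s * db) *\<^sub>R placed v a b b = vector [s * (db * l), 0]"
    by (simp add: pb vec_eq_iff forall_2)
  have "\<exists>!(p, q). p + q = s \<and> p *\<^sub>R ?pb + q *\<^sub>R ?qb = (s * db) *\<^sub>R placed v a b b"
    unfolding ub by (rule intercept_weights) (use pb2 qb2 db in \<open>auto simp: field_simps\<close>)
  from theI'[OF this] show "case edge_coeffs n v a b b db of (p, q) \<Rightarrow> p + q = s \<and>
           p *\<^sub>R (v (prv n b) - m) + q *\<^sub>R (v (nxt n b) - m) = (s * db) *\<^sub>R (v b - m)"
    unfolding edge_coeffs_def s_def by (auto intro: unrotate)
qed

section \<open>Symmetrised products\<close>

definition degree_le_one :: "(real^2 \<Rightarrow> real) \<Rightarrow> bool" where
  "degree_le_one f \<longleftrightarrow> (\<exists>h k. linear h \<and> f = (\<lambda>x. h x + k))"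

lemma degree_le_one_const: "degree_le_one (\<lambda>x. k)"
  unfolding degree_le_one_def by (intro exI[of _ "\<lambda>x. 0"] exI[of _ k]) (simp add: linear_iff)

lemma degree_le_one_nth: "degree_le_one (\<lambda>x. x $ j)"
  unfolding degree_le_one_def by (intro exI[of _ "\<lambda>x. x $ j"] exI[of _ 0]) (simp add: linear_iff)

lemma barycentric_precision:
  assumes "barycentric_coordinates n v \<Omega> lam" "x \<in> \<Omega>" "degree_le_one f"
  shows "(\<Sum>i=1..n. f (v i) * lam i x) = f x"
  using assms unfolding barycentric_coordinates_def degree_le_one_def by auto

text \<open>
  The linear part of \<open>f\<close> is applied to the vector equation for the coefficients at the vertex \<open>A\<close>
  of the diagonal \<open>A B\<close>, and its value at the midpoint \<open>m\<close> is the mean of those at \<open>A\<close> and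
  \<open>B\<close>; the constant part is taken care of by \<open>p + q = s\<close>.  Thus the neighbours \<open>P\<close>
  and \<open>Q\<close> of \<open>A\<close> are traded for the ends of the diagonal.
\<close>

lemma degree_le_one_weights:
  assumes f: "degree_le_one f" and s: "p + q = s"
    and eq: "p *\<^sub>R (P - m) + q *\<^sub>R (Q - m) = (s * d) *\<^sub>R (A - m)" and m: "m = (A + B) /\<^sub>R 2"
  shows "p * f P + q * f Q = s / 2 * ((1 + d) * f A + (1 - d) * f B)"
proof -
  obtain h k where h: "linear h" "f = (\<lambda>x. h x + k)" using f by (auto simp: degree_le_one_def)
  have "p * (h P - h m) + q * (h Q - h m) = s * d * (h A - h m)"
    using arg_cong[OF eq, of h] h(1)
    by (simp add: linear_add linear_diff linear_cmul)
  then have "p * h P + q * h Q = (p + q) * h m + s * d * (h A - h m)"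
    by (simp add: algebra_simps)
  moreover have hm: "h m = (h A + h B) / 2"
    using h(1) by (simp add: m linear_add linear_cmul)
  moreover have "p * f P + q * f Q = p * h P + q * h Q + (p + q) * k"
    by (simp add: h(2) algebra_simps)
  ultimately have "p * f P + q * f Q
      = s * ((h A + h B) / 2) + s * d * (h A - (h A + h B) / 2) + s * k"
    by (simp only: s)
  then show ?thesis by (simp add: h(2) field_simps)
qed

definition sym_prod :: "(nat \<Rightarrow> real) \<Rightarrow> (nat \<Rightarrow> real) \<Rightarrow> nat set \<Rightarrow> real" where
  "sym_prod F G ab = (if Min ab = Max ab then F (Min ab) * G (Min ab)
     else F (Min ab) * G (Max ab) + F (Max ab) * G (Min ab))"

lemma sym_prod_pair:
  "sym_prod F G {a, b} = (if a = b then F a * G a else F a * G b + F b * G a)"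
  by (auto simp: sym_prod_def min_def max_def)

lemma pairs_I_eq_image: "pairs_I n = (\<lambda>(a, b). {a, b}) ` ({1..n} \<times> {1..n})"
  by (auto simp: pairs_I_def) blast

text \<open>
  The double sum over ordered pairs is grouped by the underlying unordered pair.  A pair with two
  elements arises from two ordered pairs, which give the two terms of \<open>sym_prod\<close>.
\<close>

lemma sum_prod_eq_sum_pairs:
  fixes F G :: "nat \<Rightarrow> real"
  shows "(\<Sum>a=1..n. F a * l a) * (\<Sum>b=1..n. G b * l b)
    = (\<Sum>ab\<in>pairs_I n. sym_prod F G ab * (l (Min ab) * l (Max ab)))"
proof -
  let ?g = "\<lambda>(a, b). F a * l a * (G b * l b)" and ?p = "\<lambda>(a, b). {a, b} :: nat set"
  let ?S = "{1..n} \<times> {1..n}"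
  note im = pairs_I_eq_image[of n]
  have "(\<Sum>a=1..n. F a * l a) * (\<Sum>b=1..n. G b * l b) = sum ?g ?S"
    by (simp add: sum_product sum.cartesian_product)
  also have "\<dots> = (\<Sum>ab\<in>pairs_I n. sum ?g {x \<in> ?S. ?p x = ab})"
    unfolding im by (rule sum.image_gen) simp
  also have "\<dots> = (\<Sum>ab\<in>pairs_I n. sym_prod F G ab * (l (Min ab) * l (Max ab)))"
  proof (rule sum.cong[OF refl])
    fix ab assume ab: "ab \<in> pairs_I n"
    note M = pairs_I_Min_Max[OF ab]
    have "{x \<in> ?S. ?p x = ab} = {(Min ab, Max ab), (Max ab, Min ab)}"
      using M by (subst (1) M(3)) (auto simp: doubleton_eq_iff)
    then show "sum ?g {x \<in> ?S. ?p x = ab} = sym_prod F G ab * (l (Min ab) * l (Max ab))"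
      by (auto simp: sym_prod_def algebra_simps)
  qed
  finally show ?thesis .
qed

lemma affine_product:
  assumes "barycentric_coordinates n v \<Omega> lam" "x \<in> \<Omega>" "degree_le_one f" "degree_le_one g"
  shows "(\<Sum>ab\<in>pairs_I n. sym_prod (f \<circ> v) (g \<circ> v) ab * (lam (Min ab) x * lam (Max ab) x)) = f x * g x"
  using sum_prod_eq_sum_pairs[of "f \<circ> v" "\<lambda>a. lam a x" n "g \<circ> v"]
    barycentric_precision[OF assms(1,2)] assms(3,4) by simp

section \<open>Reproduction of symmetrised products\<close>

lemma sum_two_support:
  fixes H :: "nat \<Rightarrow> real"
  assumes "finite A" "a \<in> A" "b \<in> A" "a \<noteq> b" "\<And>i. i \<in> A \<Longrightarrow> i \<noteq> a \<Longrightarrow> i \<noteq> b \<Longrightarrow> H i = 0"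
  shows "sum H A = H a + H b"
proof -
  have "sum H A = sum H {a, b}" by (rule sum.mono_neutral_right) (use assms in auto)
  then show ?thesis using assms by simp
qed

lemma sum_four_support:
  fixes H :: "nat \<Rightarrow> real"
  assumes "finite A" "{a, b, c, d} \<subseteq> A" "distinct [a, b, c, d]"
    "\<And>i. i \<in> A \<Longrightarrow> i \<notin> {a, b, c, d} \<Longrightarrow> H i = 0"
  shows "sum H A = H a + H b + H c + H d"
proof -
  have "sum H A = sum H {a, b, c, d}" by (rule sum.mono_neutral_right) (use assms in auto)
  then show ?thesis using assms by (simp add: add.assoc)
qed

text \<open>
  Only two vertices and four edges carry a coefficient.  The pair of edges at \<open>a\<close> is evaluated by
  \<open>degree_le_one_weights\<close>, applied to \<open>f\<close> with factor \<open>g (v a)\<close> and to \<open>g\<close> with factor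
  \<open>f (v a)\<close>; its multiple of \<open>f (v a) * g (v a)\<close> is cancelled by the vertex coefficient.  The same
  at \<open>b\<close> leaves \<open>s * (2 - da - db) / 2 = 1\<close> times the symmetrised product at \<open>{a, b}\<close>.
\<close>

lemma diag_coeff_reproduces:
  assumes P: "convex_polygon n v \<Omega>" and a: "a \<in> {1..n}" and b: "b \<in> {1..n}"
    and ab: "a \<noteq> b" "b \<noteq> nxt n a" "a \<noteq> nxt n b"
    and f: "degree_le_one f" and g: "degree_le_one g"
  shows "(\<Sum>i=1..n. diag_coeff n v a b {i, i} * sym_prod (f \<circ> v) (g \<circ> v) {i, i})
       + (\<Sum>i=1..n. diag_coeff n v a b {i, nxt n i} * sym_prod (f \<circ> v) (g \<circ> v) {i, nxt n i})
       = sym_prod (f \<circ> v) (g \<circ> v) {a, b}"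
proof -
  define da db s where "da = d_fst n v a b" and "db = d_snd n v a b" and "s = s_par n v a b"
  let ?m = "midpt v a b" and ?h = "sym_prod (f \<circ> v) (g \<circ> v)" and ?c = "diag_coeff n v a b"
  have n: "n \<ge> 3" using P by (simp add: convex_polygon_def)
  have a': "prv n a \<in> {1..n}" "nxt n a \<in> {1..n}" "nxt n (prv n a) = a"
    and b': "prv n b \<in> {1..n}" "nxt n b \<in> {1..n}" "nxt n (prv n b) = b"
    using a b by (simp_all only: prv_range nxt_range nxt_prv)
  note na = neighbours_distinct[OF n a] and nb = neighbours_distinct[OF n b]
  have dist: "prv n a \<noteq> b" "prv n b \<noteq> a" "prv n a \<noteq> prv n b"
    using ab a' b' by metis+
  obtain pa qa where pqa: "edge_coeffs n v a b a da = (pa, qa)" by force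
  obtain pb qb where pqb: "edge_coeffs n v a b b db = (pb, qb)" by force
  note W = edge_coeffs_equations[OF P a b ab, folded da_def db_def s_def, unfolded pqa pqb prod.case]
  have "s = 2 / (2 - (da + db))" by (simp add: s_def s_par_def da_def db_def)
  moreover have "2 - (da + db) \<noteq> 0" using W(1) by simp
  ultimately have sd: "s * (2 - (da + db)) = 2" by (metis nonzero_eq_divide_eq)
  have vc: "(- 2 - 2 * d) / (2 - (da + db)) = - s * (1 + d)" for d
    using W(1) by (simp add: s_def s_par_def flip: da_def db_def) (simp add: field_simps)
  have key_a: "pa * u (v (prv n a)) + qa * u (v (nxt n a))
      = s / 2 * ((1 + da) * u (v a) + (1 - da) * u (v b))" if "degree_le_one u" for u
    by (rule degree_le_one_weights[OF that conjunct1[OF W(2)] conjunct2[OF W(2)]])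
      (simp add: midpt_def)
  have key_b: "pb * u (v (prv n b)) + qb * u (v (nxt n b))
      = s / 2 * ((1 + db) * u (v b) + (1 - db) * u (v a))" if "degree_le_one u" for u
    by (rule degree_le_one_weights[OF that conjunct1[OF W(3)] conjunct2[OF W(3)]])
      (simp add: midpt_def add.commute)
  have nosing: "{i, nxt n i} \<noteq> {c}" if "i \<in> {1..n}" for i c
    using neighbours_distinct[OF n that] by auto
  have vert: "?c {i, i} = (if i = a then - s * (1 + da) else if i = b then - s * (1 + db) else 0)" for i
  proof -
    have "{i, i} \<noteq> {prv n a, a}" "{i, i} \<noteq> {a, nxt n a}"
      "{i, i} \<noteq> {prv n b, b}" "{i, i} \<noteq> {b, nxt n b}"
      using na nb by (auto simp: doubleton_eq_iff)
    moreover have "{i, i} = {a, a} \<longleftrightarrow> i = a" "{i, i} = {b, b} \<longleftrightarrow> i = b" by auto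
    ultimately show ?thesis
      unfolding diag_coeff_def Let_def da_def[symmetric] db_def[symmetric] vc
      by (simp only: if_False)
  qed
  have ea: "{prv n a, a} = {prv n a, nxt n (prv n a)}" and eb: "{prv n b, b} = {prv n b, nxt n (prv n b)}"
    using a' b' by auto
  have edge: "?c {i, nxt n i} = (if i = prv n a then pa else if i = a then qa
      else if i = prv n b then pb else if i = b then qb else 0)" if i: "i \<in> {1..n}" for i
  proof -
    have "{i, nxt n i} = {prv n a, a} \<longleftrightarrow> i = prv n a" "{i, nxt n i} = {a, nxt n a} \<longleftrightarrow> i = a"
      "{i, nxt n i} = {prv n b, b} \<longleftrightarrow> i = prv n b" "{i, nxt n i} = {b, nxt n b} \<longleftrightarrow> i = b"
      unfolding ea eb by (rule edge_eq_iff[OF n i]; fact a b a' b')+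
    moreover have "{i, nxt n i} \<noteq> {a, a}" "{i, nxt n i} \<noteq> {b, b}"
      using nosing[OF i] by simp_all
    ultimately show ?thesis
      unfolding diag_coeff_def Let_def da_def[symmetric] db_def[symmetric] pqa pqb
      by (simp only: fst_conv snd_conv if_False)
  qed
  have "(\<Sum>i=1..n. ?c {i, i} * ?h {i, i}) = - s * (1 + da) * ?h {a, a} + - s * (1 + db) * ?h {b, b}"
    by (subst sum_two_support[where a = a and b = b]) (use a b ab in \<open>auto simp: vert[simplified]\<close>)
  moreover have "(\<Sum>i=1..n. ?c {i, nxt n i} * ?h {i, nxt n i})
      = pa * ?h {prv n a, a} + qa * ?h {a, nxt n a} + pb * ?h {prv n b, b} + qb * ?h {b, nxt n b}"
    by (subst sum_four_support[where a = "prv n a" and b = a and c = "prv n b" and d = b])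
      (use a b a' b' na nb ab dist in \<open>auto simp: edge edge[OF a'(1), unfolded a'(3)]
        edge[OF b'(1), unfolded b'(3)]\<close>)
  moreover have "pa * ?h {prv n a, a} + qa * ?h {a, nxt n a}
      = s * (1 + da) * ?h {a, a} + s / 2 * (1 - da) * ?h {a, b}"
  proof -
    have "pa * ?h {prv n a, a} + qa * ?h {a, nxt n a}
      = (pa * f (v (prv n a)) + qa * f (v (nxt n a))) * g (v a)
      + (pa * g (v (prv n a)) + qa * g (v (nxt n a))) * f (v a)"
      unfolding sym_prod_pair using na by (simp add: algebra_simps)
    also have "\<dots> = s * (1 + da) * ?h {a, a} + s / 2 * (1 - da) * ?h {a, b}"
      unfolding key_a[OF f] key_a[OF g] sym_prod_pair using ab by (simp add: field_simps)
    finally show ?thesis .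
  qed
  moreover have "pb * ?h {prv n b, b} + qb * ?h {b, nxt n b}
      = s * (1 + db) * ?h {b, b} + s / 2 * (1 - db) * ?h {a, b}"
  proof -
    have "pb * ?h {prv n b, b} + qb * ?h {b, nxt n b}
      = (pb * f (v (prv n b)) + qb * f (v (nxt n b))) * g (v b)
      + (pb * g (v (prv n b)) + qb * g (v (nxt n b))) * f (v b)"
      unfolding sym_prod_pair using nb by (simp add: algebra_simps)
    also have "\<dots> = s * (1 + db) * ?h {b, b} + s / 2 * (1 - db) * ?h {a, b}"
      unfolding key_b[OF f] key_b[OF g] sym_prod_pair using ab by (simp add: field_simps)
    finally show ?thesis .
  qed
  ultimately have "(\<Sum>i=1..n. ?c {i, i} * ?h {i, i}) + (\<Sum>i=1..n. ?c {i, nxt n i} * ?h {i, nxt n i})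
      = s * (2 - (da + db)) / 2 * ?h {a, b}"
    by (simp add: field_simps)
  then show ?thesis by (simp add: sd)
qed

text \<open>
  Off the diagonals the coefficients are Kronecker deltas, and distinct indices give distinct
  edges because \<open>n \<ge> 3\<close>.
\<close>

lemma coeff_reproduces:
  assumes P: "convex_polygon n v \<Omega>" and I: "ab \<in> pairs_I n"
    and f: "degree_le_one f" and g: "degree_le_one g"
  shows "(\<Sum>i=1..n. coeff n v ab {i, i} * sym_prod (f \<circ> v) (g \<circ> v) {i, i})
       + (\<Sum>i=1..n. coeff n v ab {i, nxt n i} * sym_prod (f \<circ> v) (g \<circ> v) {i, nxt n i})
       = sym_prod (f \<circ> v) (g \<circ> v) ab"
proof (cases "ab \<in> pairs_D n")
  case True
  then show ?thesis
    using diag_coeff_reproduces[OF P pairs_I_Min_Max(1,2)[OF I] pairs_D_nonadjacent[OF True] f g]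
    by (simp add: coeff_def flip: pairs_I_Min_Max(3)[OF I])
next
  case False
  let ?h = "sym_prod (f \<circ> v) (g \<circ> v)"
  have n: "n \<ge> 3" using P by (simp add: convex_polygon_def)
  note nd = neighbours_distinct(1)[OF n]
  have c: "coeff n v ab ij * ?h ij = (if ij = ab then ?h ab else 0)" for ij
    using False by (simp add: coeff_def)
  consider a where "a \<in> {1..n}" "ab = {a, a}" | a where "a \<in> {1..n}" "ab = {a, nxt n a}"
    using False I unfolding pairs_D_def pairs_V_def pairs_E_def by auto
  then show ?thesis
  proof cases
    case 1
    have "(\<Sum>i=1..n. coeff n v ab {i, i} * ?h {i, i}) = (\<Sum>i=1..n. if i = a then ?h ab else 0)"
      unfolding c by (intro sum.cong) (auto simp: 1)
    moreover have "(\<Sum>i=1..n. coeff n v ab {i, nxt n i} * ?h {i, nxt n i}) = 0"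
      unfolding c by (intro sum.neutral) (use nd in \<open>auto simp: 1\<close>)
    ultimately show ?thesis using 1 by simp
  next
    case 2
    have "(\<Sum>i=1..n. coeff n v ab {i, nxt n i} * ?h {i, nxt n i}) = (\<Sum>i=1..n. if i = a then ?h ab else 0)"
      unfolding c by (intro sum.cong) (use edge_eq_iff[OF n] 2(1) in \<open>auto simp: 2(2)\<close>)
    moreover have "(\<Sum>i=1..n. coeff n v ab {i, i} * ?h {i, i}) = 0"
      unfolding c by (intro sum.neutral) (use nd[OF 2(1)] in \<open>auto simp: 2(2)\<close>)
    ultimately show ?thesis using 2 by simp
  qed
qed

text \<open>
  The common source of the three identities: interchanging the sums turns the left-hand side into
  a combination of the \<open>\<lambda>\<^sub>a \<lambda>\<^sub>b\<close>, whose coefficients are known from \<open>coeff_reproduces\<close>.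
\<close>

lemma xi_reproduces:
  assumes P: "convex_polygon n v \<Omega>" and B: "barycentric_coordinates n v \<Omega> lam" and x: "x \<in> \<Omega>"
    and f: "degree_le_one f" and g: "degree_le_one g"
  shows "(\<Sum>i=1..n. xi n v lam {i, i} x * (f (v i) * g (v i)))
       + (\<Sum>i=1..n. xi n v lam {i, nxt n i} x *
            (f (v i) * g (v (nxt n i)) + f (v (nxt n i)) * g (v i))) = f x * g x"
proof -
  let ?h = "sym_prod (f \<circ> v) (g \<circ> v)" and ?l = "\<lambda>ab. lam (Min ab) x * lam (Max ab) x"
  have n: "n \<ge> 3" using P by (simp add: convex_polygon_def)
  have swap: "(\<Sum>i=1..n. xi n v lam (e i) x * ?h (e i))
      = (\<Sum>ab\<in>pairs_I n. (\<Sum>i=1..n. coeff n v ab (e i) * ?h (e i)) * ?l ab)" for e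
    unfolding xi_def sum_distrib_right by (subst sum.swap) (simp add: mult_ac)
  have "(\<Sum>i=1..n. xi n v lam {i, i} x * ?h {i, i}) + (\<Sum>i=1..n. xi n v lam {i, nxt n i} x * ?h {i, nxt n i})
      = (\<Sum>ab\<in>pairs_I n. ?h ab * ?l ab)"
    unfolding swap
    by (subst sum.distrib[symmetric], intro sum.cong refl)
      (simp only: coeff_reproduces[OF P _ f g] flip: distrib_right)
  also have "\<dots> = f x * g x" by (rule affine_product[OF B x f g])
  finally have total: "(\<Sum>i=1..n. xi n v lam {i, i} x * ?h {i, i})
      + (\<Sum>i=1..n. xi n v lam {i, nxt n i} x * ?h {i, nxt n i}) = f x * g x" .
  have "?h {i, i} = f (v i) * g (v i)" for i unfolding sym_prod_pair by simp
  moreover have "?h {i, nxt n i} = f (v i) * g (v (nxt n i)) + f (v (nxt n i)) * g (v i)"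
    if "i \<in> {1..n}" for i
    unfolding sym_prod_pair using neighbours_distinct(1)[OF n that] by (auto dest: sym)
  ultimately show ?thesis unfolding total[symmetric]
    by (intro arg_cong2[where f = "(+)"] sum.cong refl) simp_all
qed

lemma outer_nth: "outer u w $ i $ j = u $ i * w $ j"
  by (simp add: outer_def columnvector_def matrix_matrix_mult_def transpose_def)

theorem theorem5p1:
  fixes n :: nat and v :: "nat \<Rightarrow> real^2" and \<Omega> :: "(real^2) set"
    and lam :: "nat \<Rightarrow> real^2 \<Rightarrow> real" and x :: "real^2"
  assumes "convex_polygon n v \<Omega>"
    and "barycentric_coordinates n v \<Omega> lam"
    and "x \<in> \<Omega>"
  shows "(\<Sum>i=1..n. xi n v lam {i, i} x) + (\<Sum>i=1..n. 2 * xi n v lam {i, nxt n i} x) = 1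
       \<and> (\<Sum>i=1..n. xi n v lam {i, i} x *\<^sub>R midpt v i i)
           + (\<Sum>i=1..n. (2 * xi n v lam {i, nxt n i} x) *\<^sub>R midpt v i (nxt n i)) = x
       \<and> (\<Sum>i=1..n. xi n v lam {i, i} x *\<^sub>R outer (v i) (v i))
           + (\<Sum>i=1..n. xi n v lam {i, nxt n i} x *\<^sub>R
                (outer (v i) (v (nxt n i)) + outer (v (nxt n i)) (v i))) = outer x x"
proof (intro conjI)
  note rep = xi_reproduces[OF assms]
  show "(\<Sum>i=1..n. xi n v lam {i, i} x) + (\<Sum>i=1..n. 2 * xi n v lam {i, nxt n i} x) = 1"
    using rep[OF degree_le_one_const[of 1] degree_le_one_const[of 1]] by (simp add: mult.commute)
  show "(\<Sum>i=1..n. xi n v lam {i, i} x *\<^sub>R midpt v i i)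
           + (\<Sum>i=1..n. (2 * xi n v lam {i, nxt n i} x) *\<^sub>R midpt v i (nxt n i)) = x"
    using rep[OF degree_le_one_nth degree_le_one_const[of 1]]
    by (simp add: vec_eq_iff midpt_def)
  show "(\<Sum>i=1..n. xi n v lam {i, i} x *\<^sub>R outer (v i) (v i))
           + (\<Sum>i=1..n. xi n v lam {i, nxt n i} x *\<^sub>R
                (outer (v i) (v (nxt n i)) + outer (v (nxt n i)) (v i))) = outer x x"
    using rep[OF degree_le_one_nth degree_le_one_nth]
    by (simp add: vec_eq_iff outer_nth)
qed

end
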